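(* Let $a \geq 3$ be an integer. Then there exist integers $M, n_0, i_0 \geq 1$ and periodic sequences $\bm{z}^{(0)}, \dots, \bm{z}^{(M-1)}$ (each $\bm{z}^{(j)} = (z^{(j)}_k)_{k \geq 1}$) and $\bm{w}^{(1)}, \dots, \bm{w}^{(i_0)}$ (each $\bm{w}^{(i)} = (w^{(i)}_n)_{n\ge 1}$), all with values in $\{0,1\}$, such that for all integers $n \geq n_0$ with $\gcd(a, F_n) = 1$, the Zeckendorf representation of $(a^{-1} \bmod F_n)$ is given by \[ (a^{-1} \bmod F_n) = \sum_{i = i_0}^{n-1} z^{(n \bmod M)}_{n-i} F_i + \sum_{i=1}^{i_0 - 1} w^{(i)}_n F_i , \] i.e. this equality holds and the coefficients of $F_1, \dots, F_{n-1}$ in it lie in $\{0,1\}$ with no two consecutive indices both having coefficient $1$.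
   Context: $(F_n)_{n\ge 1}$ is the Fibonacci sequence, $F_1=F_2=1$, $F_n = F_{n-1}+F_{n-2}$. For integers $a$ and $m \geq 1$ with $\gcd(a,m)=1$, $(a^{-1} \bmod m)$ denotes the unique $b \in \{1,\dots,m\}$ with $ab \equiv 1 \pmod m$. For integers $n$ and $M\ge1$, $(n \bmod M)$ is the least nonnegative residue of $n$ modulo $M$. The Zeckendorf representation of a positive integer $N$ is its expression $N=\sum_{i=1}^m d_i F_i$ with $d_i\in\{0,1\}$ and $d_id_{i+1}=0$ for all $i$ (unique up to the interchangeable use of $F_1$ and $F_2$). *)

theory Defs
  imports "HOL-Number_Theory.Number_Theory"
begin

text \<open>
  The Fibonacci sequence is the library's \<^const>\<open>fib\<close>, with \<open>fib 1 = fib 2 = 1\<close>.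

  The representative of the inverse is taken in \<open>{1..m}\<close>, so that it is \<open>1\<close> (not \<open>0\<close>) for
  \<open>m = 1\<close>. The value is meaningful only for \<open>m \<ge> 1\<close> and \<open>a\<close> coprime to \<open>m\<close>.
\<close>

definition inverse_mod :: "int \<Rightarrow> nat \<Rightarrow> nat" where
  "inverse_mod a m = (THE b. b \<in> {1..m} \<and> [a * int b = 1] (mod int m))"

text \<open>
  Sequences are indexed by \<open>k \<ge> 1\<close>; the value of the HOL function at \<open>0\<close> is irrelevant.
  Periodic means purely periodic, without a preperiod.
\<close>

definition periodic :: "(nat \<Rightarrow> 'a) \<Rightarrow> bool" where
  "periodic s \<longleftrightarrow> (\<exists>p\<ge>1. \<forall>k\<ge>1. s (k + p) = s k)"

text \<open>
  Only the digits \<open>d 1, \<dots>, d m\<close> matter. Leading zeros are allowed, and the value \<open>1\<close> may be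
  represented by either of \<open>fib 1\<close> and \<open>fib 2\<close>.
\<close>

definition is_zeckendorf :: "nat \<Rightarrow> nat \<Rightarrow> (nat \<Rightarrow> nat) \<Rightarrow> bool" where
  "is_zeckendorf N m d \<longleftrightarrow>
     N = (\<Sum>i = 1..m. d i * fib i) \<and>
     (\<forall>i\<in>{1..m}. d i \<in> {0, 1}) \<and>
     (\<forall>i\<in>{1..<m}. d i * d (i + 1) = 0)"

end

theory Submission
  imports Defs "HOL-Library.FuncSet"
begin

text \<open>
  The inverse of \<open>a\<close> modulo \<open>fib n\<close> is \<open>(1 + c * fib n) div a\<close>, where \<open>0 < c < a\<close> depends only on
  \<open>fib n\<close> modulo \<open>a\<close>, hence only on \<open>n\<close> modulo a period \<open>M\<close>. Its leading Zeckendorf digits are the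
  digits of \<open>c / a\<close> in base golden ratio. That expansion is purely periodic: its remainders, taken
  together with their conjugates, move in a finite set on which the expansion step is injective.
  If the remainder after \<open>k\<close> digits is \<open>(p + q * golden) / a\<close>, then what is left of
  \<open>a\<close> times the inverse is exactly \<open>p * fib (n - k) + q * fib (n - k + 1) + 1\<close>. For fixed \<open>n - k = i0\<close>
  this takes finitely many values, periodically in \<open>n\<close>; for \<open>i0\<close> large it is small enough to be
  expanded with the indices below \<open>i0\<close>.
\<close>

section \<open>Periods of injective maps on finite sets, and of Fibonacci residues\<close>

text \<open>Restricted to \<open>S\<close>, only finitely many different iterates exist, so two of
  them coincide; injectivity cancels the shorter one. Injectivity thus excludes a preperiod, and one
  \<open>P\<close> serves all of \<open>S\<close>.\<close>

lemma funpow_id_on_if_inj_on_finite: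
  assumes "finite S" "f ` S \<subseteq> S" "inj_on f S"
  obtains P where "P \<ge> 1" "\<And>x. x \<in> S \<Longrightarrow> (f ^^ P) x = x"
proof -
  have closed: "(f ^^ i) x \<in> S" if "x \<in> S" for i x
    using that assms(2) by (induction i) auto
  have inj: "inj_on (f ^^ i) S" for i
  proof (induction i)
    case (Suc i)
    then show ?case
      using closed assms(3) by (auto simp: inj_on_def)
  qed simp
  have "(\<lambda>i. restrict (f ^^ i) S) ` UNIV \<subseteq> S \<rightarrow>\<^sub>E S"
    using closed by auto
  moreover have "finite (S \<rightarrow>\<^sub>E S)"
    using assms(1) by (simp add: finite_PiE)
  ultimately have "finite (range (\<lambda>i. restrict (f ^^ i) S))"
    using finite_subset by blast
  then have "\<not> inj (\<lambda>i::nat. restrict (f ^^ i) S)"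
    using finite_imageD infinite_UNIV_nat by blast
  then obtain i j where ij: "i < j" "restrict (f ^^ i) S = restrict (f ^^ j) S"
    unfolding inj_def by (metis linorder_neq_iff)
  show thesis
  proof (rule that[of "j - i"])
    fix x assume x: "x \<in> S"
    have "(f ^^ i) ((f ^^ (j - i)) x) = (f ^^ j) x"
      using ij(1) by (metis add_diff_inverse_nat comp_apply funpow_add less_imp_not_less)
    also have "\<dots> = (f ^^ i) x"
      using ij(2) x by (metis restrict_apply')
    finally show "(f ^^ (j - i)) x = x"
      using inj[of i] closed[OF x] x by (auto simp: inj_on_def)
  qed (use ij in simp)
qed

lemma funpow_add_period:
  assumes "(f ^^ P) x = x"
  shows "(f ^^ (k + P * l)) x = (f ^^ k) x"
proof -
  have "(f ^^ (P * l)) x = x"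
    using assms by (induction l) (simp_all add: funpow_add)
  then show ?thesis
    by (simp add: funpow_add)
qed

text \<open>Pairs of consecutive residues evolve by an injective map, because the recurrence can be
  run backwards.\<close>

lemma fib_mod_periodic:
  fixes a :: int
  assumes "a \<ge> 1"
  obtains M where "M \<ge> 1" "\<And>n. [int (fib n) = int (fib (n mod M))] (mod a)"
proof -
  define f where "f = (\<lambda>(x, y). (y, (x + y) mod a))"
  define S where "S = {0..<a} \<times> {0..<a}"
  have "inj_on f S"
  proof (rule inj_onI, clarify)
    fix x y x' y'
    assume *: "(x, y) \<in> S" "(x', y') \<in> S" "f (x, y) = f (x', y')"
    then have "[x + y = x' + y] (mod a)" "y = y'"
      by (auto simp: f_def cong_def)
    then have "[x = x'] (mod a)"
      by (simp add: cong_add_rcancel)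
    with * \<open>y = y'\<close> show "x = x' \<and> y = y'"
      by (auto simp: S_def cong_def)
  qed
  moreover have "f ` S \<subseteq> S"
    using assms by (auto simp: f_def S_def)
  moreover have "finite S"
    by (simp add: S_def)
  ultimately obtain M where M: "M \<ge> 1" "\<And>x. x \<in> S \<Longrightarrow> (f ^^ M) x = x"
    using funpow_id_on_if_inj_on_finite by metis
  define s where "s = (0::int, 1 mod a)"
  have sS: "s \<in> S"
    using assms by (auto simp: s_def S_def)
  have orbit: "(f ^^ n) s = (int (fib n) mod a, int (fib (Suc n)) mod a)" for n
    by (induction n) (auto simp: f_def s_def mod_simps add.commute)
  show thesis
  proof (rule that[OF M(1)])
    fix n
    have "(f ^^ n) s = (f ^^ (n mod M)) s"
      using funpow_add_period[OF M(2)[OF sS], of "n mod M" "n div M"] by simp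
    then show "[int (fib n) = int (fib (n mod M))] (mod a)"
      by (simp add: orbit cong_def)
  qed
qed

section \<open>Greedy Zeckendorf expansion\<close>

text \<open>Greedy choice: subtracting \<open>fib (Suc m)\<close> leaves less than
  \<open>fib m\<close>. The clause that digits vanish from \<open>m\<close> on carries the
  induction: digit \<open>m\<close> of the remainder is 0, so a 1 may be placed at
  \<open>Suc m\<close>.\<close>

lemma zeckendorf_exists:
  assumes "N < fib m"
  shows "\<exists>d. (\<forall>i. d i \<in> {0, 1}) \<and> (\<forall>i. d i * d (i + 1) = 0) \<and> (\<forall>i\<ge>m. d i = 0)
    \<and> N = (\<Sum>i = 1..<m. d i * fib i)"
  using assms
proof (induction m arbitrary: N rule: fib.induct)
  case (3 m)
  show ?case
  proof (cases "N < fib (Suc m)")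
    case True
    from "3.IH"(1)[OF this] obtain d where d: "\<forall>i. d i \<in> {0, 1}" "\<forall>i. d i * d (i + 1) = 0"
      "\<forall>i\<ge>Suc m. d i = 0" "N = (\<Sum>i = 1..<Suc m. d i * fib i)"
      by blast
    then show ?thesis
      by (intro exI[of _ d]) auto
  next
    case False
    with "3.prems" have "N - fib (Suc m) < fib m"
      by simp
    from "3.IH"(2)[OF this] obtain d where d: "\<forall>i. d i \<in> {0, 1}" "\<forall>i. d i * d (i + 1) = 0"
      "\<forall>i\<ge>m. d i = 0" "N - fib (Suc m) = (\<Sum>i = 1..<m. d i * fib i)"
      by blast
    let ?d = "d(Suc m := 1)"
    have "(\<Sum>i = 1..<Suc (Suc m). ?d i * fib i) = (\<Sum>i = 1..<Suc m. ?d i * fib i) + fib (Suc m)"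
      by simp
    also have "(\<Sum>i = 1..<Suc m. ?d i * fib i) = (\<Sum>i = 1..<m. d i * fib i)"
      using d(3) by (cases m) (auto intro!: sum.cong)
    finally have "N = (\<Sum>i = 1..<Suc (Suc m). ?d i * fib i)"
      using d(4) False by simp
    then show ?thesis
      using d by (intro exI[of _ ?d]) auto
  qed
qed auto

section \<open>The golden ratio and the growth of Fibonacci combinations\<close>

definition golden :: real where
  "golden = (1 + sqrt 5) / 2"

lemma golden_square: "golden * golden = golden + 1"
  by (simp add: golden_def field_simps)

lemma golden_bounds: "3 / 2 < golden" "golden < 2"
proof -
  have "sqrt 5 < sqrt (3\<^sup>2)" "sqrt (2\<^sup>2) < sqrt 5"
    by (subst real_sqrt_less_iff; simp)+
  then show "3 / 2 < golden" "golden < 2"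
    by (auto simp: golden_def)
qed

lemma golden_cancel: "golden * ((golden - 1) * x) = x"
proof -
  have "golden * ((golden - 1) * x) = (golden * golden - golden) * x"
    by (simp add: algebra_simps)
  then show ?thesis
    by (simp add: golden_square)
qed

lemma golden_mult: "golden * (x + y * golden) = y + (x + y) * golden"
proof -
  have "golden * (x + y * golden) = x * golden + y * (golden * golden)"
    by (simp add: algebra_simps)
  then show ?thesis
    by (simp add: golden_square algebra_simps)
qed

text \<open>A one-step form of Binet's formula; the error is a power of the conjugate
  \<open>1 - golden\<close>, of absolute value below 1.\<close>

lemma fib_Suc_golden: "real (fib (Suc m)) = golden * fib m + (1 - golden) ^ m"
proof (induction m)
  case (Suc m)
  have "golden * (golden * fib m + (1 - golden) ^ m) + (1 - golden) ^ Suc m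
      = golden * golden * fib m + (1 - golden) ^ m"
    by (simp add: algebra_simps)
  then show ?case
    using Suc by (simp add: golden_square algebra_simps)
qed simp

lemma fib_combination:
  "p * real (fib m) + q * real (fib (Suc m)) = (p + q * golden) * fib m + q * (1 - golden) ^ m"
  unfolding fib_Suc_golden by (simp add: algebra_simps)

lemma golden_conj_power_tendsto_0: "(\<lambda>m. q * (1 - golden) ^ m) \<longlonglongrightarrow> 0"
proof -
  have "\<bar>1 - golden\<bar> < 1"
    using golden_bounds by auto
  then show ?thesis
    by (intro tendsto_mult_right_zero LIMSEQ_abs_realpow_zero2)
qed

text \<open>The error term tends to 0. For integer coefficients, exceeding -1 means being
  nonnegative, which also covers a vanishing main term.\<close>

lemma eventually_fib_combination_gt_minus_1:
  assumes "p + q * golden \<ge> 0"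
  shows "\<forall>\<^sub>F m in sequentially. p * real (fib m) + q * real (fib (Suc m)) > -1"
proof -
  have "\<forall>\<^sub>F m in sequentially. q * (1 - golden) ^ m > -1"
    by (rule order_tendstoD(1)[OF golden_conj_power_tendsto_0]) simp
  then show ?thesis
  proof eventually_elim
    case (elim m)
    moreover have "(p + q * golden) * fib m \<ge> 0"
      using assms by simp
    ultimately show ?case
      unfolding fib_combination by linarith
  qed
qed

lemma filterlim_real_fib: "filterlim (\<lambda>m. real (fib m)) at_top sequentially"
proof (rule filterlim_at_top_mono[OF _ always_eventually])
  show "filterlim (\<lambda>m. real m - 1) at_top sequentially"
    using filterlim_tendsto_add_at_top[OF tendsto_const[of "-1"] filterlim_real_sequentially] by simp
  have "m \<le> fib m + 1" for m
  proof (induction m rule: fib.induct)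
    case (3 n)
    moreover have "fib (Suc n) \<ge> 1"
      using fib_neq_0_nat[of "Suc n"] by simp
    moreover have "fib n \<ge> 1" if "n > 0"
      using fib_neq_0_nat[OF that] by simp
    ultimately show ?case
      by (cases "n = 0") auto
  qed auto
  then show "\<forall>m. real m - 1 \<le> real (fib m)"
    by (smt (verit) of_nat_1 of_nat_add of_nat_mono)
qed

text \<open>The bound 1 leaves room for the summand 1 in \<open>a\<close> times the inverse.\<close>

lemma eventually_fib_combination_gt_1:
  assumes "p + q * golden > 0"
  shows "\<forall>\<^sub>F m in sequentially. p * real (fib m) + q * real (fib (Suc m)) > 1"
proof -
  have "filterlim (\<lambda>m. q * (1 - golden) ^ m + (p + q * golden) * real (fib m)) at_top sequentially"
    by (rule filterlim_tendsto_add_at_top[OF golden_conj_power_tendsto_0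
          filterlim_tendsto_pos_mult_at_top[OF tendsto_const assms filterlim_real_fib]])
  then have "\<forall>\<^sub>F m in sequentially. q * (1 - golden) ^ m + (p + q * golden) * real (fib m) > 1"
    by (simp add: filterlim_at_top_dense)
  then show ?thesis
    unfolding fib_combination by (simp add: add.commute)
qed

section \<open>The golden ratio expansion and its natural extension\<close>

text \<open>
  The pair \<open>(p, q)\<close> stands for the number \<open>(p + q * golden) / a\<close> in \<open>[0, 1)\<close>, on which the
  step acts as multiplication by \<open>golden\<close> modulo \<open>1\<close>.
\<close>

definition beta_digit :: "int \<Rightarrow> int \<times> int \<Rightarrow> nat" where
  "beta_digit a = (\<lambda>(p, q). if golden * (p + q * golden) \<ge> a then 1 else 0)"

definition beta_step :: "int \<Rightarrow> int \<times> int \<Rightarrow> int \<times> int" where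
  "beta_step a s = (snd s - a * int (beta_digit a s), fst s + snd s)"

text \<open>
  The natural extension of the golden ratio expansion, with the algebraic conjugate
  \<open>p + q * (1 - golden)\<close> as second coordinate. The strict bounds on the conjugate make the ranges
  belonging to the two digits disjoint, so the step is injective.
\<close>

definition beta_domain :: "int \<Rightarrow> (int \<times> int) set" where
  "beta_domain a = {(p, q). 0 \<le> p + q * golden \<and> p + q * golden < a
     \<and> - golden * a < p + q * (1 - golden) \<and> p + q * (1 - golden) < a
     \<and> ((golden - 1) * a \<le> p + q * golden \<longrightarrow> (1 - golden) * a < p + q * (1 - golden))}"

lemma beta_digit_eq_1_iff: "beta_digit a (p, q) = 1 \<longleftrightarrow> (golden - 1) * a \<le> p + q * golden"
proof -
  have "golden * (p + q * golden) \<ge> golden * ((golden - 1) * a) \<longleftrightarrow> p + q * golden \<ge> (golden - 1) * a"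
    using golden_bounds by simp
  then show ?thesis
    by (simp add: beta_digit_def golden_cancel)
qed

lemma beta_digit_in: "beta_digit a s \<in> {0, 1}"
  by (cases s) (simp add: beta_digit_def)

lemma beta_step_value:
  assumes "beta_step a (p, q) = (p', q')"
  shows "p' + q' * golden = golden * (p + q * golden) - a * real (beta_digit a (p, q))"
    "p' + q' * (1 - golden) = (1 - golden) * (p + q * (1 - golden)) - a * real (beta_digit a (p, q))"
proof -
  have 1: "p' = q - a * int (beta_digit a (p, q))" "q' = p + q"
    using assms by (auto simp: beta_step_def)
  have "q * (golden * golden) = q * (golden + 1)"
    by (simp add: golden_square)
  then show "p' + q' * golden = golden * (p + q * golden) - a * real (beta_digit a (p, q))"
    "p' + q' * (1 - golden) = (1 - golden) * (p + q * (1 - golden)) - a * real (beta_digit a (p, q))"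
    unfolding 1 by (simp_all add: algebra_simps)
qed

text \<open>The step multiplies the conjugate by the negative contraction \<open>1 - golden\<close>
  and subtracts \<open>a\<close> times the digit. Digit 0 sends it into the open interval from
  \<open>(1 - golden) * a\<close> to \<open>a\<close>, digit 1 into that from
  \<open>- golden * a\<close> to \<open>(1 - golden) * a\<close>.\<close>

lemma
  assumes "a > 0" "(p, q) \<in> beta_domain a" "beta_step a (p, q) = (p', q')"
  shows beta_step_in_domain: "(p', q') \<in> beta_domain a"
    and beta_step_digit_1: "beta_digit a (p, q) = 1 \<Longrightarrow> p' + q' * golden < (golden - 1) * a"
    and beta_step_digit_conj:
      "beta_digit a (p, q) = 1 \<longleftrightarrow> p' + q' * (1 - golden) < (1 - golden) * a"
proof -
  \<comment> \<open>Every product with \<open>golden\<close> gets its own letter, so that both digit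
    cases become linear arithmetic.\<close>
  define X Y X' Y' A where defs: "X = p + q * golden" "Y = p + q * (1 - golden)"
    "X' = p' + q' * golden" "Y' = p' + q' * (1 - golden)" "A = real_of_int a"
  define z where "z = beta_digit a (p, q)"
  define B C where BC: "B = (golden - 1) * A" "C = (golden - 1) * Y"
  define E F where EF: "E = golden * X" "F = golden * A"
  have n: "(1 - golden) * A = - B" "(1 - golden) * Y = - C" "- golden * A = - F"
    by (simp_all add: BC EF algebra_simps)
  have X'Y': "X' = E - A * z" "Y' = - C - A * z"
    using beta_step_value[OF assms(3)] n(2) by (simp_all add: defs z_def EF)
  have D: "0 \<le> X" "X < A" "- F < Y" "Y < A" "B \<le> X \<Longrightarrow> - B < Y"
    using assms(2) unfolding n[symmetric] by (auto simp: beta_domain_def defs BC)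
  have z: "z = 1 \<longleftrightarrow> B \<le> X" "z \<in> {0, 1}"
    using beta_digit_eq_1_iff[of a p q] beta_digit_in by (auto simp: z_def defs BC)
  have g: "golden - 1 > 0" "golden > 0"
    using golden_bounds by auto
  have gB: "golden * B = A" "(golden - 1) * F = A" "(golden - 1) * B = A - B"
    using golden_cancel[of A] by (simp_all add: BC EF algebra_simps)
  have AB: "0 < B" "B < A" "F = B + A"
    using assms(1) golden_bounds by (simp_all add: BC EF defs algebra_simps)
  have EC: "E < F" "0 \<le> E" "C < B"
    using D g by (simp_all add: BC EF)
  have goal: "0 \<le> X' \<and> X' < A \<and> - F < Y' \<and> Y' < A \<and> (B \<le> X' \<longrightarrow> - B < Y')
      \<and> (z = 1 \<longrightarrow> X' < B) \<and> (z = 1 \<longleftrightarrow> Y' < - B)"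
  proof (cases "z = 1")
    case True
    then have "golden * B \<le> E" "(golden - 1) * (- B) < C"
      using D(5) z(1) g unfolding BC(2) EF by (simp_all only: mult_le_cancel_left_pos mult_less_cancel_left_pos)
    then have "A \<le> E" "B - A < C"
      using gB by simp_all
    moreover have "X' = E - A" "Y' = - C - A"
      using X'Y' True by simp_all
    ultimately show ?thesis
      using AB EC True by auto
  next
    case False
    then have "z = 0"
      using z(2) by auto
    have "E < golden * B" "(golden - 1) * (- F) < C"
      using D(3) False z(1) g unfolding BC(2) EF(1)
      by (simp_all only: mult_less_cancel_left_pos not_le)
    then have "E < A" "- A < C"
      using gB by simp_all
    moreover have "X' = E" "Y' = - C"
      using X'Y' \<open>z = 0\<close> by simp_all
    ultimately show ?thesis
      using AB EC \<open>z = 0\<close> by auto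
  qed
  show "(p', q') \<in> beta_domain a"
    using goal unfolding n[symmetric] by (auto simp: beta_domain_def defs BC)
  show "beta_digit a (p, q) = 1 \<Longrightarrow> p' + q' * golden < (golden - 1) * a"
    using goal by (simp add: defs z_def BC)
  show "beta_digit a (p, q) = 1 \<longleftrightarrow> p' + q' * (1 - golden) < (1 - golden) * a"
    using goal unfolding n[symmetric] by (simp add: defs z_def)
qed

lemma beta_step_domain:
  assumes "a > 0"
  shows "beta_step a ` beta_domain a \<subseteq> beta_domain a"
  using beta_step_in_domain[OF assms] by (metis image_subsetI surj_pair)

text \<open>The conjugate of the image reveals the digit; for a fixed digit the step is an
  invertible affine map.\<close>

lemma inj_on_beta_step:
  assumes "a > 0"
  shows "inj_on (beta_step a) (beta_domain a)"
proof (rule inj_onI)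
  fix s t assume st: "s \<in> beta_domain a" "t \<in> beta_domain a" "beta_step a s = beta_step a t"
  have "beta_digit a s = 1 \<longleftrightarrow> beta_digit a t = 1"
    using beta_step_digit_conj[OF assms] st by (metis surj_pair)
  then have "beta_digit a s = beta_digit a t"
    using beta_digit_in[of a s] beta_digit_in[of a t] by auto
  with st(3) show "s = t"
    by (simp add: beta_step_def prod_eq_iff)
qed

text \<open>A number and its conjugate are both bounded, and their difference is \<open>q\<close>
  times \<open>2 * golden - 1\<close>, that is sqrt 5. This bounds \<open>q\<close>, and then
  \<open>p\<close>.\<close>

lemma finite_beta_domain: "finite (beta_domain a)"
proof (rule finite_subset)
  show "beta_domain a \<subseteq> {-7 * \<bar>a\<bar>..7 * \<bar>a\<bar>} \<times> {-3 * \<bar>a\<bar>..3 * \<bar>a\<bar>}"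
  proof (clarify, unfold mem_Sigma_iff atLeastAtMost_iff)
    fix p q assume "(p, q) \<in> beta_domain a"
    then have D: "0 \<le> p + q * golden" "p + q * golden < a"
      "- golden * a < p + q * (1 - golden)" "p + q * (1 - golden) < a"
      by (auto simp: beta_domain_def)
    then have a: "real_of_int a > 0"
      by linarith
    have ga: "golden * a < 2 * a"
      using a golden_bounds by simp
    have "\<bar>real_of_int q\<bar> * 1 \<le> \<bar>real_of_int q\<bar> * \<bar>2 * golden - 1\<bar>"
      by (rule mult_left_mono) (use golden_bounds in auto)
    also have "\<dots> = \<bar>q * (2 * golden - 1)\<bar>"
      by (simp add: abs_mult)
    also have "q * (2 * golden - 1) = (p + q * golden) - (p + q * (1 - golden))"
      by (simp add: algebra_simps)
    also have "\<bar>(p + q * golden) - (p + q * (1 - golden))\<bar> \<le> 3 * a"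
      using D ga a by linarith
    finally have q: "\<bar>real_of_int q\<bar> \<le> 3 * a"
      by simp
    have "\<bar>q * golden\<bar> \<le> real_of_int (3 * a) * 2"
      unfolding abs_mult using q golden_bounds by (intro mult_mono) auto
    then have "\<bar>real_of_int p\<bar> \<le> 7 * a"
      using D a by linarith
    with q have "\<bar>q\<bar> \<le> 3 * a" "\<bar>p\<bar> \<le> 7 * a"
      by linarith+
    then show "(-7 * \<bar>a\<bar> \<le> p \<and> p \<le> 7 * \<bar>a\<bar>) \<and> -3 * \<bar>a\<bar> \<le> q \<and> q \<le> 3 * \<bar>a\<bar>"
      by linarith
  qed
qed simp

text \<open>After a digit 1 the value lies below \<open>(golden - 1) * a\<close>, the threshold for
  the next digit 1.\<close>

lemma beta_digit_consecutive:
  assumes "a > 0" "s \<in> beta_domain a"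
  shows "beta_digit a s * beta_digit a (beta_step a s) = 0"
proof -
  obtain p q p' q' where "s = (p, q)" "beta_step a s = (p', q')"
    by fastforce
  then show ?thesis
    using beta_step_digit_1[of a p q p' q'] beta_digit_eq_1_iff[of a p' q'] assms
      beta_digit_in[of a s] beta_digit_in[of a "beta_step a s"] by auto
qed

lemma int_beta_domain:
  assumes "0 \<le> c" "c < a"
  shows "(c, 0) \<in> beta_domain a"
proof -
  have "0 < golden * a" "(1 - golden) * a < 0"
    using assms golden_bounds by (auto simp: mult_less_0_iff)
  then show ?thesis
    using assms by (simp add: beta_domain_def)
qed

section \<open>Exact expansion of integers along the orbit\<close>

text \<open>Integer counterpart of \<open>(p + q * golden) * golden ^ m\<close>: multiplying the
  pair by \<open>golden\<close> amounts to raising \<open>m\<close> by one.\<close>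

definition fib_value :: "nat \<Rightarrow> int \<times> int \<Rightarrow> int" where
  "fib_value m s = fst s * int (fib m) + snd s * int (fib (Suc m))"

lemma fib_value_beta_step:
  "fib_value m (beta_step a s) = fib_value (Suc m) s - a * int (beta_digit a s * fib m)"
  by (simp add: fib_value_def beta_step_def algebra_simps)

text \<open>Telescoping of \<open>fib_value_beta_step\<close>: the digit read at orbit position
  \<open>n - i - 1\<close> carries the weight \<open>fib i\<close>.\<close>

lemma fib_value_orbit:
  assumes "k \<le> n"
  shows "fib_value n s =
    fib_value (n - k) ((beta_step a ^^ k) s)
    + a * int (\<Sum>i = n - k..<n. beta_digit a ((beta_step a ^^ (n - i - 1)) s) * fib i)"
  using assms
proof (induction k)
  case (Suc k)
  then have eq: "Suc (n - Suc k) = n - k"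
    by simp
  have "{n - Suc k..<n} = insert (n - Suc k) {n - k..<n}"
    using Suc.prems by auto
  moreover have "n - (n - Suc k) - 1 = k"
    using Suc.prems by simp
  ultimately have "(\<Sum>i = n - Suc k..<n. beta_digit a ((beta_step a ^^ (n - i - 1)) s) * fib i)
      = beta_digit a ((beta_step a ^^ k) s) * fib (n - Suc k)
        + (\<Sum>i = n - k..<n. beta_digit a ((beta_step a ^^ (n - i - 1)) s) * fib i)"
    using Suc.prems by simp
  then show ?case
    using Suc by (simp add: fib_value_beta_step eq algebra_simps)
qed simp

text \<open>Finiteness of the domain makes one threshold work for all remainders. The sharper bound
  by \<open>fib m\<close> applies after a digit 1 and later forces the next lower digit to be
  0.\<close>

lemma eventually_fib_value_bounds:
  fixes a :: int
  shows "\<forall>\<^sub>F m in sequentially. \<forall>s\<in>beta_domain a. fib_value (Suc m) s \<ge> 0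
    \<and> fib_value (Suc m) s + 1 < a * int (fib (Suc m))
    \<and> (fst s + snd s * golden < (golden - 1) * a \<longrightarrow> fib_value (Suc m) s + 1 < a * int (fib m))"
    (is "\<forall>\<^sub>F m in _. \<forall>s\<in>_. ?B m s")
proof (rule eventually_ball_finite[OF finite_beta_domain], rule ballI)
  fix s assume s: "s \<in> beta_domain a"
  obtain p q where pq: "s = (p, q)" by fastforce
  have D: "0 \<le> p + q * golden" "(a - p) + (- q) * golden > 0"
    using s by (auto simp: beta_domain_def pq)
  have v: "real_of_int (fib_value m s) = p * real (fib m) + q * real (fib (Suc m))" for m
    by (simp add: fib_value_def pq)
  have 1: "\<forall>\<^sub>F m in sequentially. fib_value m s \<ge> 0"
    using eventually_fib_combination_gt_minus_1[OF D(1)]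
    by eventually_elim (unfold v[symmetric], linarith)
  have 2: "\<forall>\<^sub>F m in sequentially. fib_value m s + 1 < a * int (fib m)"
    using eventually_fib_combination_gt_1[OF D(2)]
  proof eventually_elim
    case (elim m)
    then have "real_of_int (fib_value m s + 1) < real_of_int (a * int (fib m))"
      by (simp add: v algebra_simps)
    then show ?case by linarith
  qed
  have 3: "\<forall>\<^sub>F m in sequentially. fib_value (Suc m) s + 1 < a * int (fib m)"
    if "p + q * golden < (golden - 1) * a"
  proof -
    \<comment> \<open>\<open>fib_value (Suc m) s\<close> is \<open>fib_value m\<close> of
      \<open>golden\<close> times the pair, so the hypothesis is scaled by \<open>golden\<close>
      first.\<close>
    have "golden * (p + q * golden) < golden * ((golden - 1) * a)"
      using that golden_bounds by simp
    then have "(a - q) + (- p - q) * golden > 0"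
      unfolding golden_mult golden_cancel by (simp add: algebra_simps)
    from eventually_fib_combination_gt_1[OF this] show ?thesis
    proof eventually_elim
      case (elim m)
      then have "real_of_int (fib_value (Suc m) s + 1) < real_of_int (a * int (fib m))"
        by (simp add: v algebra_simps)
      then show ?case by linarith
    qed
  qed
  have "\<forall>\<^sub>F m in sequentially. fib_value (Suc m) s \<ge> 0 \<and> fib_value (Suc m) s + 1 < a * int (fib (Suc m))"
    using eventually_conj[OF 1 2] eventually_sequentially_Suc[of
        "\<lambda>m. fib_value m s \<ge> 0 \<and> fib_value m s + 1 < a * int (fib m)"]
    by blast
  with 3 show "\<forall>\<^sub>F m in sequentially. ?B m s"
    unfolding pq by (auto simp: eventually_conj_iff)
qed

section \<open>Inverses modulo \<open>m\<close> as exact quotients by \<open>a\<close>\<close>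

lemma inverse_mod_eqI:
  assumes "b \<in> {1..m}" "[a * int b = 1] (mod int m)"
  shows "inverse_mod a m = b"
  unfolding inverse_mod_def
proof (rule the_equality)
  fix b' assume b': "b' \<in> {1..m} \<and> [a * int b' = 1] (mod int m)"
  then have "[a * int b' = a * int b] (mod int m)"
    using assms(2) by (metis cong_sym cong_trans)
  moreover have "coprime a (int m)"
    using assms(2) coprime_iff_invertible_int by blast
  ultimately have "[int b' = int b] (mod int m)"
    by (simp add: cong_mult_lcancel)
  then have "int m dvd int b' - int b"
    by (simp add: cong_iff_dvd_diff)
  moreover have "\<bar>int b' - int b\<bar> < int m"
    using assms(1) b' by auto
  ultimately show "b' = b"
    using dvd_imp_le_int[of "int b' - int b" "int m"] by auto
qed (use assms in simp)

lemma inverse_mod_mult: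
  fixes a c :: int
  assumes "0 \<le> c" "c < a" "m \<ge> 1" "[c * int m = -1] (mod a)"
  shows "a * int (inverse_mod a m) = 1 + c * int m"
proof -
  have "a dvd 1 + c * int m"
    using assms(4) by (simp add: cong_iff_dvd_diff add.commute)
  then obtain b where b: "1 + c * int m = a * b" ..
  have "a * b > 0"
    using assms b by (smt (verit) mult_nonneg_nonneg of_nat_0_le_iff)
  then have "b > 0"
    using assms by (simp add: zero_less_mult_iff)
  \<comment> \<open>As \<open>c\<close> is at most \<open>a - 1\<close> and \<open>m\<close> at
    least 1, \<open>1 + c * m\<close> is at most \<open>a * m\<close>; this puts \<open>b\<close> in
    the required range.\<close>
  have "c * int m \<le> (a - 1) * int m"
    using assms by (intro mult_right_mono) auto
  then have "a * b \<le> a * int m"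
    using b assms(3) by (simp add: algebra_simps)
  then have "b \<le> int m"
    using assms by simp
  have "inverse_mod a m = nat b"
    using \<open>b > 0\<close> \<open>b \<le> int m\<close> b[symmetric] by (intro inverse_mod_eqI) (auto simp: cong_iff_dvd_diff)
  then show ?thesis
    using \<open>b > 0\<close> b by simp
qed

section \<open>Construction of the periodic digit sequences\<close>

theorem theorem1p1:
  fixes a :: int
  assumes "a \<ge> 3"
  shows "\<exists>(M::nat) (n0::nat) (i0::nat) (z :: nat \<Rightarrow> nat \<Rightarrow> nat) (w :: nat \<Rightarrow> nat \<Rightarrow> nat).
    M \<ge> 1 \<and> n0 \<ge> 1 \<and> i0 \<ge> 1 \<and>
    (\<forall>j<M. periodic (z j) \<and> (\<forall>k\<ge>1. z j k \<in> {0, 1})) \<and>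
    (\<forall>i\<in>{1..i0}. periodic (w i) \<and> (\<forall>n\<ge>1. w i n \<in> {0, 1})) \<and>
    (\<forall>n\<ge>n0. coprime a (int (fib n)) \<longrightarrow>
       inverse_mod a (fib n) =
         (\<Sum>i = i0..n - 1. z (n mod M) (n - i) * fib i) + (\<Sum>i = 1..i0 - 1. w i n * fib i) \<and>
       is_zeckendorf (inverse_mod a (fib n)) (n - 1)
         (\<lambda>i. if i \<ge> i0 then z (n mod M) (n - i) else w i n))"
proof -
  have a: "a > 0" "a \<ge> 1"
    using assms by auto
  obtain M where M: "M \<ge> 1" "\<And>n. [int (fib n) = int (fib (n mod M))] (mod a)"
    using fib_mod_periodic[OF a(2)] by metis
  obtain P where P: "P \<ge> 1" "\<And>s. s \<in> beta_domain a \<Longrightarrow> (beta_step a ^^ P) s = s"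
    using funpow_id_on_if_inj_on_finite[OF finite_beta_domain beta_step_domain[OF a(1)]
        inj_on_beta_step[OF a(1)]] by metis
  \<comment> \<open>\<open>c\<close> is minus the inverse of \<open>fib j\<close> modulo
    \<open>a\<close>; without coprimality any residue serves as a default, which makes the choice
    total in \<open>j\<close>.\<close>
  have "\<exists>c. 0 \<le> c \<and> c < a \<and> (coprime a (int (fib j)) \<longrightarrow> [c * int (fib j) = -1] (mod a))" for j
  proof (cases "coprime a (int (fib j))")
    case True
    then obtain x where x: "[int (fib j) * x = 1] (mod a)"
      using cong_solve_coprime_int by (metis coprime_commute)
    then have "[- (int (fib j) * x) = -1] (mod a)"
      by (simp add: cong_minus_minus_iff)
    then have "[(- x) mod a * int (fib j) = -1] (mod a)"
      by (simp add: cong_def mod_simps mult.commute)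
    then show ?thesis
      using a by (intro exI[of _ "(- x) mod a"]) auto
  qed (use a in auto)
  then obtain c where c: "\<And>j. 0 \<le> c j" "\<And>j. c j < a"
    "\<And>j. coprime a (int (fib j)) \<Longrightarrow> [c j * int (fib j) = -1] (mod a)"
    by metis
  define s where "s j k = (beta_step a ^^ k) (c j, 0)" for j k
  have s0: "(c j, 0) \<in> beta_domain a" for j
    using c int_beta_domain by simp
  have s_Suc: "s j (Suc k) = beta_step a (s j k)" for j k
    by (simp add: s_def)
  have s_in: "s j k \<in> beta_domain a" for j k
    by (induction k) (use s0 beta_step_domain[OF a(1)] in \<open>auto simp: s_def\<close>)
  have s_period: "s j (k + P * l) = s j k" for j k l
    unfolding s_def by (rule funpow_add_period[OF P(2)[OF s0]])
  \<comment> \<open>Digits are numbered from 1, orbit points from 0.\<close>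
  define z where "z j k = beta_digit a (s j (k - 1))" for j k
  from eventually_happens'[OF sequentially_bot eventually_fib_value_bounds[of a]]
  obtain m where m: "\<forall>t\<in>beta_domain a. fib_value (Suc m) t \<ge> 0
    \<and> fib_value (Suc m) t + 1 < a * int (fib (Suc m))
    \<and> (fst t + snd t * golden < (golden - 1) * a \<longrightarrow> fib_value (Suc m) t + 1 < a * int (fib m))"
    ..
  define i0 where "i0 = Suc m"
  \<comment> \<open>Fixing one expansion per number makes the low digits a function of the remainder
    alone, so they inherit its periodicity.\<close>
  have "\<forall>N. \<exists>d. N < fib i0 \<longrightarrow> (\<forall>i. d i \<in> {0, 1}) \<and> (\<forall>i. d i * d (i + 1) = 0)
    \<and> (\<forall>i\<ge>i0. d i = 0) \<and> N = (\<Sum>i = 1..<i0. d i * fib i)"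
    using zeckendorf_exists by blast
  from choice[OF this] obtain d where d: "\<And>N i. N < fib i0 \<Longrightarrow> d N i \<in> {0, 1::nat}"
    "\<And>N i. N < fib i0 \<Longrightarrow> d N i * d N (i + 1) = 0"
    "\<And>N. N < fib i0 \<Longrightarrow> N = (\<Sum>i = 1..<i0. d N i * fib i)"
    by blast
  \<comment> \<open>The part of the inverse left for indices below \<open>i0\<close>; for the
    remainders arising from an inverse the division is exact.\<close>
  define r where "r t = nat ((fib_value i0 t + 1) div a)" for t
  have r_less: "r t < f" if "fib_value i0 t \<ge> 0" "fib_value i0 t + 1 < a * int f" for t f
  proof -
    have "(fib_value i0 t + 1) div a < int f"
      using that(2) a minus_mod_eq_mult_div[of "fib_value i0 t + 1" a]
        pos_mod_sign[of a "fib_value i0 t + 1"]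
        mult_less_cancel_left_pos[of a "(fib_value i0 t + 1) div a" "int f"] by linarith
    moreover have "(fib_value i0 t + 1) div a \<ge> 0"
      using that(1) a by (simp add: pos_imp_zdiv_nonneg_iff)
    ultimately show ?thesis
      by (simp add: r_def)
  qed
  have r: "r t < fib i0" if "t \<in> beta_domain a" for t
    using m that by (auto simp: i0_def intro!: r_less)
  have r': "r t < fib m" if "t \<in> beta_domain a" "fst t + snd t * golden < (golden - 1) * a" for t :: "int \<times> int"
    using m that by (auto simp: i0_def intro!: r_less)
  \<comment> \<open>\<open>n + (P - 1) * i0\<close> is congruent to \<open>n - i0\<close> modulo \<open>P\<close>, without truncated subtraction.\<close>
  define t where "t n = s (n mod M) (n + (P - 1) * i0)" for n
  define w where "w i n = d (r (t n)) i" for i n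
  have t_in: "t n \<in> beta_domain a" for n
    by (simp add: t_def s_in)
  have t_eq: "t n = s (n mod M) (n - i0)" if "n \<ge> i0" for n
  proof -
    have "n + (P - 1) * i0 = (n - i0) + P * i0"
      using that P(1) by (cases P) auto
    then show ?thesis
      by (simp add: t_def s_period)
  qed
  have z_periodic: "periodic (z j)" for j
    unfolding periodic_def
  proof (intro exI[of _ P] conjI allI impI)
    fix k :: nat assume "k \<ge> 1"
    then have "k + P - 1 = (k - 1) + P * 1" by simp
    then show "z j (k + P) = z j k"
      unfolding z_def by (metis s_period)
  qed (rule P)
  have w_periodic: "periodic (w i)" for i
    unfolding periodic_def
  \<comment> \<open>A multiple of \<open>M\<close> preserves the residue of \<open>n\<close>, a
    multiple of \<open>P\<close> the point on the orbit.\<close>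
  proof (intro exI[of _ "P * M"] conjI allI impI)
    fix n :: nat
    have "n + P * M + (P - 1) * i0 = (n + (P - 1) * i0) + P * M" by simp
    then have "t (n + P * M) = t n"
      unfolding t_def by (simp only: s_period mod_mult_self2 mod_mult_self1)
    then show "w i (n + P * M) = w i n"
      by (simp add: w_def)
  qed (use P(1) M(1) in simp)
  have z01: "z j k \<in> {0, 1}" for j k
    unfolding z_def by (rule beta_digit_in)
  have w01: "w i n \<in> {0, 1}" for i n
    unfolding w_def by (rule d(1)[OF r[OF t_in]])
  have main: "inverse_mod a (fib n) =
         (\<Sum>i = i0..n - 1. z (n mod M) (n - i) * fib i) + (\<Sum>i = 1..i0 - 1. w i n * fib i)"
    (is "?b = ?Z + ?W")
    if n: "n \<ge> Suc i0" and cop: "coprime a (int (fib n))" for n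
  proof -
    let ?j = "n mod M"
    have "coprime a (int (fib ?j))"
      using cop M(2)[of n] cong_imp_coprime by (metis coprime_commute)
    then have "[c ?j * int (fib ?j) = -1] (mod a)"
      by (rule c)
    then have "[c ?j * int (fib n) = -1] (mod a)"
      using M(2)[of n] cong_scalar_left cong_trans by blast
    moreover have "fib n \<ge> 1"
      using n fib_neq_0_nat[of n] by simp
    ultimately have "a * int ?b = 1 + c ?j * int (fib n)"
      using c by (intro inverse_mod_mult) auto
    also have "c ?j * int (fib n) = fib_value n (c ?j, 0)"
      by (simp add: fib_value_def)
    also have "\<dots> = fib_value (n - (n - i0)) ((beta_step a ^^ (n - i0)) (c ?j, 0)) + a * int
       (\<Sum>i = n - (n - i0)..<n. beta_digit a ((beta_step a ^^ (n - i - 1)) (c ?j, 0)) * fib i)"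
      by (rule fib_value_orbit) simp
    also have "(\<Sum>i = n - (n - i0)..<n. beta_digit a ((beta_step a ^^ (n - i - 1)) (c ?j, 0)) * fib i)
        = ?Z"
      using n by (intro sum.cong) (auto simp: z_def s_def)
    also have "fib_value (n - (n - i0)) ((beta_step a ^^ (n - i0)) (c ?j, 0)) = fib_value i0 (t n)"
      using n by (simp add: t_eq s_def)
    finally have eq: "fib_value i0 (t n) + 1 = a * (int ?b - int ?Z)"
      by (simp add: algebra_simps)
    then have "r (t n) = nat (int ?b - int ?Z)"
      using a by (simp add: r_def)
    \<comment> \<open>Nonnegativity of \<open>fib_value\<close> at \<open>i0\<close> ensures that
      \<open>nat\<close> truncates nothing.\<close>
    moreover have "int ?b - int ?Z \<ge> 0"
      using eq bspec[OF m t_in[of n]] a unfolding i0_def by (smt (verit) mult_pos_neg)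
    moreover have "r (t n) = ?W"
      using d(3)[OF r[OF t_in[of n]]] unfolding w_def i0_def
      by (simp add: atLeastLessThanSuc_atLeastAtMost)
    ultimately show ?thesis
      by linarith
  qed
  \<comment> \<open>Where the two digit blocks meet: a digit 1 at \<open>i0\<close> makes the
    remainder smaller than \<open>fib m\<close>, so index \<open>m = i0 - 1\<close> cannot be
    used.\<close>
  have boundary: "w m n * z (n mod M) (n - i0) = 0" if n: "n \<ge> Suc i0" and "m \<ge> 1" for n
  proof (cases "z (n mod M) (n - i0) = 1")
    case True
    let ?u = "s (n mod M) (n - i0 - 1)"
    have tu: "t n = beta_step a ?u"
      using n by (simp add: t_eq Suc_diff_Suc Suc_le_eq flip: s_Suc)
    obtain p q p' q' where u: "?u = (p, q)" "t n = (p', q')"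
      by fastforce
    have "p' + q' * golden < (golden - 1) * a"
      using True beta_step_digit_1[OF a(1), of p q p' q'] s_in[of "n mod M" "n - i0 - 1"] tu u
      by (simp add: z_def)
    then have "r (t n) < fib m"
      using r'[OF t_in, of n] u by simp
    moreover have "w m n * fib m \<le> (\<Sum>i = 1..<i0. w i n * fib i)"
      using \<open>m \<ge> 1\<close> by (intro member_le_sum) (auto simp: i0_def)
    ultimately have "w m n * fib m < fib m"
      using d(3)[OF r[OF t_in[of n]]] unfolding w_def by linarith
    then show ?thesis
      by simp
  qed (use z01[of "n mod M" "n - i0"] in auto)
  have consecutive: "(if i \<ge> i0 then z (n mod M) (n - i) else w i n)
      * (if i + 1 \<ge> i0 then z (n mod M) (n - (i + 1)) else w (i + 1) n) = 0"
    if n: "n \<ge> Suc i0" and i: "i \<in> {1..<n - 1}" for n i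
  proof -
    \<comment> \<open>Both digits high, one on each side of the boundary, or both low.\<close>
    consider "i \<ge> i0" | "i = m" | "i + 1 < i0"
      unfolding i0_def by linarith
    then show ?thesis
    proof cases
      case 1
      have "n - i - 1 = Suc (n - (i + 1) - 1)"
        using i by auto
      then show ?thesis
        using beta_digit_consecutive[OF a(1) s_in[of "n mod M" "n - (i + 1) - 1"]] 1
        by (simp add: z_def s_Suc mult.commute)
    next
      case 2
      then show ?thesis
        using boundary[OF n] i by (simp add: i0_def)
    next
      case 3
      then show ?thesis
        using d(2)[OF r[OF t_in[of n]]] by (simp add: w_def)
    qed
  qed
  have zeck: "is_zeckendorf (inverse_mod a (fib n)) (n - 1)
         (\<lambda>i. if i \<ge> i0 then z (n mod M) (n - i) else w i n)" (is "is_zeckendorf _ _ ?e")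
    if n: "n \<ge> Suc i0" and cop: "coprime a (int (fib n))" for n
  proof -
    have split: "{1..n - 1} = {i0..n - 1} \<union> {1..i0 - 1}"
      using n by (auto simp: i0_def)
    have "(\<Sum>i = 1..n - 1. ?e i * fib i)
        = (\<Sum>i = i0..n - 1. ?e i * fib i) + (\<Sum>i = 1..i0 - 1. ?e i * fib i)"
      unfolding split by (rule sum.union_disjoint) (auto simp: i0_def)
    also have "(\<Sum>i = i0..n - 1. ?e i * fib i) = (\<Sum>i = i0..n - 1. z (n mod M) (n - i) * fib i)"
      by (intro sum.cong) auto
    also have "(\<Sum>i = 1..i0 - 1. ?e i * fib i) = (\<Sum>i = 1..i0 - 1. w i n * fib i)"
      by (intro sum.cong) (auto simp: i0_def)
    finally show ?thesis
      unfolding is_zeckendorf_def using main[OF n cop] z01 w01 consecutive[OF n] by auto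
  qed
  show ?thesis
    \<comment> \<open>With \<open>n0 = Suc i0\<close> the difference \<open>n - i0\<close> is at
      least 1, so the digit at \<open>i0\<close> comes from an actual orbit step.\<close>
    using M(1) z_periodic w_periodic z01 w01 main zeck
    by (intro exI[of _ M] exI[of _ "Suc i0"] exI[of _ i0] exI[of _ z] exI[of _ w])
      (simp add: i0_def)
qed

end
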